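(* Let five squares (arbitrarily rotated) with pairwise disjoint interiors be contained in the unit square, with total side length $S_5$. Suppose that the packing admits an axis-parallel guillotine cut, namely, an axis-parallel line that avoids the interiors of all five squares and separates them into two nonempty subfamilies. Then $S_5\le 2$.
   Context: A square means a closed solid (filled) square in the Euclidean plane $\mathbb{R}^2$, of arbitrary orientation; the five packed squares may have different side lengths and orientations. The unit square is $[0,1]^2$, and "axis-parallel line" means a horizontal or vertical line, i.e. one parallel to a side of the unit square. The line separates the squares into two nonempty subfamilies if at least one of the squares lies in each of the two closed half-planes bounded by the line (each square lies in one of these two half-planes, since the line avoids its interior). *)

theory Defs
  imports "HOL-Analysis.Analysis"
begin

definition solid_square :: "(real^2) set \<Rightarrow> real \<Rightarrow> bool" where
  "solid_square Q s \<longleftrightarrow> s > 0 \<and>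
     (\<exists>p u v. norm u = s \<and> norm v = s \<and> orthogonal u v \<and>
        Q = {p + a *\<^sub>R u + b *\<^sub>R v | a b. a \<in> {0..1} \<and> b \<in> {0..1}})"

definition unit_square :: "(real^2) set" where
  "unit_square = {x. \<forall>k. 0 \<le> x $ k \<and> x $ k \<le> 1}"

definition square_packing :: "'i set \<Rightarrow> ('i \<Rightarrow> (real^2) set) \<Rightarrow> ('i \<Rightarrow> real) \<Rightarrow> bool" where
  "square_packing I Q s \<longleftrightarrow>
     (\<forall>i\<in>I. solid_square (Q i) (s i) \<and> Q i \<subseteq> unit_square) \<and>
     (\<forall>i\<in>I. \<forall>j\<in>I. i \<noteq> j \<longrightarrow> interior (Q i) \<inter> interior (Q j) = {})"

text \<open>The index \<open>k :: 2\<close> selects the direction of the cutting line: the line on which the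
  \<open>k\<close>-th coordinate equals \<open>c\<close> is vertical for \<open>k = 1\<close> and horizontal for \<open>k = 2\<close>.\<close>

definition axis_guillotine_cut :: "'i set \<Rightarrow> ('i \<Rightarrow> (real^2) set) \<Rightarrow> 2 \<Rightarrow> real \<Rightarrow> bool" where
  "axis_guillotine_cut I Q k c \<longleftrightarrow>
     (\<forall>i\<in>I. {x. x $ k = c} \<inter> interior (Q i) = {}) \<and>
     (\<exists>i\<in>I. Q i \<subseteq> {x. x $ k \<le> c}) \<and>
     (\<exists>i\<in>I. Q i \<subseteq> {x. x $ k \<ge> c})"

end

theory Submission
  imports Defs
begin

text \<open>
  Say that the cut is vertical. It leaves two rectangles of height \<open>1\<close> whose widths \<open>w\<close> and \<open>w'\<close>
  satisfy \<open>w + w' = 1\<close>, and these hold one and four, or two and three, of the squares. In a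
  rectangle of width \<open>w\<close> every side is at most \<open>w\<close>, and moreover the total side length is

  \<^item> at most \<open>max w 1\<close> for two squares,
  \<^item> at most \<open>max (2 * w) 1\<close> for three squares,
  \<^item> at most \<open>w + 1\<close> for four squares.

  Hence a split into one and four gives at most \<open>w + (w' + 1) = 2\<close>. For a split into two (width \<open>w\<close>)
  and three (width \<open>w'\<close>), the bounds are \<open>2 * w + 2 * w' = 2\<close> if \<open>w' \<ge> 1/2\<close>, and \<open>1 + 1\<close> otherwise.

  The bound for four squares (\<open>four_squares_in_rectangle\<close>) is Cauchy-Schwarz: the areas add up to at
  most \<open>w\<close>, so the sides add up to at most \<open>2 * sqrt w \<le> w + 1\<close>.

  The bounds for two and three squares come from climbing through the packing. Suppose that the sum
  of the sides exceeds \<open>w\<close>, respectively \<open>2 * w\<close>. Since no side exceeds \<open>w\<close>, any two of the sides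
  then add up to more than \<open>w\<close>, so the horizontal projections of any two squares overlap in more than
  a point. A line that separates two of the squares is therefore not vertical, and one of
  the two lies below the other along every vertical line that meets both (\<open>below_total\<close>). Three
  objects with such a comparison of any two of them always include a chain \<open>A\<close> below \<open>B\<close> below \<open>C\<close>.
  Start at the bottom of \<open>A\<close>, leave it upwards above some abscissa \<open>t1\<close>, pass through \<open>B\<close> from
  abscissa \<open>t1\<close> on its lower boundary to some abscissa \<open>t2\<close> on its upper boundary, and from there rise
  into \<open>C\<close> and on to the top of \<open>C\<close>. If the
  height gained within each square is at least its side, then the sum of the sides is at most the
  height of the rectangle.

  Good choices of \<open>t1\<close> and \<open>t2\<close> exist. The abscissae at which \<open>A\<close> reaches its own side length above
  the floor form an interval, with a point at distance at least \<open>sA\<close> from the left wall of the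
  rectangle and a point at distance at least \<open>sA\<close> from the right wall
  (\<open>bottom_square_interval\<close>); the same holds for \<open>C\<close> and the ceiling. For two squares
  the two intervals meet, which is all that is needed. For three squares the middle one has to be
  crossed from one interval to the other. A tilted square is taller than its side, and this surplus
  pays for entering and leaving it away from its lowest and highest vertices
  (\<open>middle_square_crossing\<close>).
\<close>

section \<open>Tilted squares in coordinates\<close>

definition parallelogram :: "'a::real_vector \<Rightarrow> 'a \<Rightarrow> 'a \<Rightarrow> 'a set" where
 "parallelogram p u v = {p + a *\<^sub>R u + b *\<^sub>R v | a b. a \<in> {0..1::real} \<and> b \<in> {0..1}}"

text \<open>Moving the base point to the next vertex keeps the parallelogram and, if \<open>v\<close> is \<open>u\<close> turned by a right
  angle, keeps the orientation as well. Repeating the move therefore runs through the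
  four ways to describe a square by a vertex and a positively oriented pair of edges.\<close>

lemma parallelogram_turn_subset: "parallelogram p u v \<subseteq> parallelogram (p + u) v (- u)"
proof
  fix x assume "x \<in> parallelogram p u v"
  then obtain a b where ab: "a \<in> {0..1::real}" "b \<in> {0..1}" and x: "x = p + a *\<^sub>R u + b *\<^sub>R v"
    unfolding parallelogram_def by blast
  have "x = (p + u) + b *\<^sub>R v + (1 - a) *\<^sub>R (- u)"
    by (simp add: x algebra_simps)
  moreover have "1 - a \<in> {0..1}" using ab by simp
  ultimately show "x \<in> parallelogram (p + u) v (- u)"
    unfolding parallelogram_def using ab(2) by blast
qed

lemma parallelogram_turn: "parallelogram p u v = parallelogram (p + u) v (- u)"
proof
  show "parallelogram (p + u) v (- u) \<subseteq> parallelogram p u v"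
  proof -
    have "parallelogram (p + u) v (- u) \<subseteq> parallelogram (p + u + v) (- u) (- v)"
      by (rule parallelogram_turn_subset)
    also have "\<dots> \<subseteq> parallelogram (p + v) (- v) u"
      using parallelogram_turn_subset[of "p + u + v" "- u" "- v"] by simp
    also have "\<dots> \<subseteq> parallelogram p u v"
      using parallelogram_turn_subset[of "p + v" "- v" u] by simp
    finally show ?thesis .
  qed
qed (rule parallelogram_turn_subset)

lemma parallelogram_swap: "parallelogram p u v = parallelogram p v u"
proof -
  have "parallelogram p u v \<subseteq> parallelogram p v u" for p u v :: 'a
  proof
    fix x assume "x \<in> parallelogram p u v"
    then obtain a b where ab: "a \<in> {0..1::real}" "b \<in> {0..1}" "x = p + b *\<^sub>R v + a *\<^sub>R u"
      unfolding parallelogram_def by (auto simp: ac_simps)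
    then show "x \<in> parallelogram p v u"
      unfolding parallelogram_def by blast
  qed
  then show ?thesis by blast
qed

text \<open>The cut may run in either direction. Instead of reducing one case to the other by a reflection, all
  that follows calls coordinate \<open>k\<close> horizontal and the remaining coordinate \<open>l\<close> vertical.\<close>

lemma UNIV_2_distinct: "k \<noteq> l \<Longrightarrow> (UNIV :: 2 set) = {k, l}"
proof -
  assume "k \<noteq> l"
  then have "i = k \<or> i = l" for i
    using exhaust_2[of i] exhaust_2[of k] exhaust_2[of l] by auto
  then show ?thesis by blast
qed

lemma inner_2_distinct:
  fixes x y :: "real^2"
  assumes "k \<noteq> l"
  shows "x \<bullet> y = x $ k * y $ k + x $ l * y $ l"
  using assms by (simp add: inner_vec_def UNIV_2_distinct[OF assms])

lemma vec_2_eq: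
  fixes x y :: "real^2"
  assumes "k \<noteq> l"
  shows "x = y \<longleftrightarrow> x $ k = y $ k \<and> x $ l = y $ l"
proof -
  have "(\<forall>i. x $ i = y $ i) \<longleftrightarrow> (\<forall>i\<in>{k, l}. x $ i = y $ i)"
    unfolding UNIV_2_distinct[OF assms, symmetric] by (rule ball_UNIV[symmetric])
  then show ?thesis unfolding vec_eq_iff by simp
qed

text \<open>One of the four rotations of an edge vector by right angles lies in the closed first quadrant. So
  every square has a vertex \<open>p\<close> with edge vectors \<open>s (c, d)\<close> and \<open>s (-d, c)\<close> where \<open>c\<close> and \<open>d\<close> are the
  cosine and sine of an angle in the first quadrant: \<open>p\<close> is the lowest vertex, \<open>p + s (c, d)\<close> the
  rightmost one, \<open>p + s (-d, c)\<close> the leftmost one, and \<open>s (c + d)\<close> is both the width and the height.\<close>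

lemma solid_square_first_quadrant:
  assumes sq: "solid_square Q s" and kl: "k \<noteq> l"
  obtains c d p where "0 \<le> c" "0 \<le> d" "c\<^sup>2 + d\<^sup>2 = (1::real)"
    "\<And>x. x \<in> Q \<longleftrightarrow> (\<exists>a\<in>{0..1}. \<exists>b\<in>{0..1}.
        x $ k = p $ k + s * (a * c - b * d) \<and> x $ l = p $ l + s * (a * d + b * c))"
proof -
  let ?quarter = "\<lambda>u v::real^2. v $ k = - u $ l \<and> v $ l = u $ k"
  from sq obtain p u v where s: "s > 0" and nu: "norm u = s" and nv: "norm v = s"
    and uv: "orthogonal u v" and Q: "Q = parallelogram p u v"
    unfolding solid_square_def parallelogram_def by blast
  have nu2: "u $ k * u $ k + u $ l * u $ l = s\<^sup>2" and nv2: "v $ k * v $ k + v $ l * v $ l = s\<^sup>2"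
    using nu nv by (metis dot_square_norm inner_2_distinct[OF kl])+
  have o: "u $ k * v $ k + u $ l * v $ l = 0"
    using uv by (simp add: orthogonal_def inner_2_distinct[OF kl])
  \<comment> \<open>The determinant of the two edges; its sign says whether \<open>v\<close> is \<open>u\<close> turned to the left or to the right.\<close>
  define m where "m = u $ k * v $ l - u $ l * v $ k"
  have "m\<^sup>2 = (s\<^sup>2)\<^sup>2"
  proof -
    have "m\<^sup>2 = (u $ k * u $ k + u $ l * u $ l) * (v $ k * v $ k + v $ l * v $ l)
        - (u $ k * v $ k + u $ l * v $ l)\<^sup>2"
      unfolding m_def by (simp add: power2_eq_square algebra_simps)
    then show ?thesis by (simp add: nu2 nv2 o power2_eq_square)
  qed
  then have m: "m = s\<^sup>2 \<or> m = - s\<^sup>2"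
    by (simp only: power2_eq_iff)
  have vk: "s\<^sup>2 * v $ k = - m * u $ l" and vl: "s\<^sup>2 * v $ l = m * u $ k"
  proof -
    have "s\<^sup>2 * v $ k + m * u $ l = u $ k * (u $ k * v $ k + u $ l * v $ l)"
      unfolding nu2[symmetric] m_def by (simp add: algebra_simps)
    then show "s\<^sup>2 * v $ k = - m * u $ l" by (simp add: o)
    have "s\<^sup>2 * v $ l - m * u $ k = u $ l * (u $ k * v $ k + u $ l * v $ l)"
      unfolding nu2[symmetric] m_def by (simp add: algebra_simps)
    then show "s\<^sup>2 * v $ l = m * u $ k" by (simp add: o)
  qed
  have cancel: "y = z" if "s\<^sup>2 * y = s\<^sup>2 * z" for y z :: real
    using that s by simp
  have "\<exists>p u v. Q = parallelogram p u v \<and> ?quarter u v \<and> norm u = s"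
  proof (cases "m = s\<^sup>2")
    case True
    then have "?quarter u v" using vk vl cancel[of "v $ k" "- u $ l"] cancel[of "v $ l" "u $ k"] by simp
    then show ?thesis using Q nu by blast
  next
    case False
    then have "m = - s\<^sup>2" using m by blast
    then have "?quarter v u"
      using vk vl cancel[of "v $ k" "u $ l"] cancel[of "- v $ l" "u $ k"] by simp
    then show ?thesis using Q nv parallelogram_swap by blast
  qed
  then obtain p1 u1 v1 where 1: "Q = parallelogram p1 u1 v1" "?quarter u1 v1" "norm u1 = s" by blast
  have n1: "norm v1 = s"
    using 1 by (simp add: norm_eq_sqrt_inner inner_2_distinct[OF kl] add.commute)
  have "\<exists>p u v. Q = parallelogram p u v \<and> ?quarter u v \<and> norm u = s \<and> 0 \<le> u $ k \<and> 0 \<le> u $ l"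
  proof -
    have *: "Q = parallelogram (p1 + u1) v1 (- u1)" "Q = parallelogram (p1 + u1 + v1) (- u1) (- v1)"
       "Q = parallelogram (p1 + v1) (- v1) u1"
      using 1(1) parallelogram_turn[of p1 u1 v1] parallelogram_turn[of "p1 + u1" v1 "- u1"]
        parallelogram_turn[of "p1 + u1 + v1" "- u1" "- v1"] by simp_all
    consider "0 \<le> u1 $ k" "0 \<le> u1 $ l" | "0 \<le> u1 $ k" "u1 $ l \<le> 0"
      | "u1 $ k \<le> 0" "u1 $ l \<le> 0" | "u1 $ k \<le> 0" "0 \<le> u1 $ l" by linarith
    then show ?thesis
    proof cases
      case 1 then show ?thesis using \<open>Q = parallelogram p1 u1 v1\<close> \<open>?quarter u1 v1\<close> \<open>norm u1 = s\<close> by blast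
    next
      case 2
      then show ?thesis using *(1) 1(2) n1
        by (intro exI[of _ "p1 + u1"] exI[of _ v1] exI[of _ "- u1"]) simp
    next
      case 3
      then show ?thesis using *(2) 1(2,3)
        by (intro exI[of _ "p1 + u1 + v1"] exI[of _ "- u1"] exI[of _ "- v1"]) simp
    next
      case 4
      then show ?thesis using *(3) 1(2) n1
        by (intro exI[of _ "p1 + v1"] exI[of _ "- v1"] exI[of _ "u1"]) simp
    qed
  qed
  then obtain q w z where q: "Q = parallelogram q w z" "?quarter w z" "norm w = s" "0 \<le> w $ k" "0 \<le> w $ l"
    by blast
  show thesis
  proof (rule that[of "w $ k / s" "w $ l / s" q])
    have "w $ k * w $ k + w $ l * w $ l = s\<^sup>2"
      using q(3) by (metis dot_square_norm inner_2_distinct[OF kl])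
    then show "(w $ k / s)\<^sup>2 + (w $ l / s)\<^sup>2 = 1"
      using s by (simp add: field_simps power2_eq_square)
    fix x
    show "x \<in> Q \<longleftrightarrow> (\<exists>a\<in>{0..1}. \<exists>b\<in>{0..1}.
        x $ k = q $ k + s * (a * (w $ k / s) - b * (w $ l / s)) \<and>
        x $ l = q $ l + s * (a * (w $ l / s) + b * (w $ k / s)))"
    proof -
      have *: "s * (a * (w $ k / s) - b * (w $ l / s)) = a * w $ k + b * z $ k"
        "s * (a * (w $ l / s) + b * (w $ k / s)) = a * w $ l + b * z $ l" for a b
        using s q(2) by (simp_all add: field_simps)
      have mem: "x \<in> parallelogram q w z \<longleftrightarrow>
          (\<exists>a\<in>{0..1}. \<exists>b\<in>{0..1}. x = q + a *\<^sub>R w + b *\<^sub>R z)"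
        unfolding parallelogram_def by blast
      show ?thesis
        unfolding q(1) mem vec_2_eq[OF kl] * by (simp add: add.assoc)
    qed
  qed (use q(4,5) s in simp_all)
qed

lemma solid_square_uminus:
  assumes "solid_square Q s" shows "solid_square (uminus ` Q) s"
proof -
  from assms obtain p u v where s: "s > 0" and uv: "norm u = s" "norm v = s" "orthogonal u v"
    and Q: "Q = {p + a *\<^sub>R u + b *\<^sub>R v | a b. a \<in> {0..1} \<and> b \<in> {0..1}}"
    unfolding solid_square_def by blast
  have "uminus ` Q = {- p + a *\<^sub>R (- u) + b *\<^sub>R (- v) | a b. a \<in> {0..1} \<and> b \<in> {0..1}}"
  proof (intro equalityI subsetI)
    fix x assume "x \<in> {- p + a *\<^sub>R (- u) + b *\<^sub>R (- v) | a b. a \<in> {0..1} \<and> b \<in> {0..1}}"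
    then obtain a b where "a \<in> {0..1}" "b \<in> {0..1}" "x = - (p + a *\<^sub>R u + b *\<^sub>R v)"
      by auto
    then show "x \<in> uminus ` Q" unfolding Q by blast
  next
    fix x assume "x \<in> uminus ` Q"
    then obtain a b where ab: "a \<in> {0..1}" "b \<in> {0..1}" and "x = - (p + a *\<^sub>R u + b *\<^sub>R v)"
      unfolding Q by blast
    then have "x = - p + a *\<^sub>R (- u) + b *\<^sub>R (- v)" by simp
    with ab show "x \<in> {- p + a *\<^sub>R (- u) + b *\<^sub>R (- v) | a b. a \<in> {0..1} \<and> b \<in> {0..1}}"
      by blast
  qed
  then show ?thesis
    unfolding solid_square_def using s uv
    by (intro conjI exI[of _ "- p"] exI[of _ "- u"] exI[of _ "- v"])
      (simp_all only: norm_minus_cancel orthogonal_def inner_minus_left inner_minus_right)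
qed

lemma solid_square_image:
  assumes "solid_square Q s"
  obtains f p where "linear f" "Q = (+) p ` f ` cbox 0 (1::real^2)" "\<bar>det (matrix f)\<bar> = s\<^sup>2"
proof -
  from assms obtain p u v where s: "s > 0" and uv: "norm u = s" "norm v = s" "orthogonal u v"
    and Q: "Q = {p + a *\<^sub>R u + b *\<^sub>R v | a b. a \<in> {0..1} \<and> b \<in> {0..1}}"
    unfolding solid_square_def by blast
  define f where "f = (\<lambda>x::real^2. (x $ 1) *\<^sub>R u + (x $ 2) *\<^sub>R v)"
  have lin: "linear f"
    unfolding f_def by (auto intro!: linearI simp: algebra_simps)
  have "Q = (+) p ` f ` cbox 0 (1::real^2)"
  proof (intro equalityI subsetI)
    fix x assume "x \<in> Q"
    then obtain a b where ab: "a \<in> {0..1}" "b \<in> {0..1}" "x = p + a *\<^sub>R u + b *\<^sub>R v"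
      unfolding Q by blast
    then have "vector [a, b] \<in> cbox 0 (1::real^2)" "x = p + f (vector [a, b])"
      by (auto simp: mem_box_cart f_def forall_2 add.assoc)
    then show "x \<in> (+) p ` f ` cbox 0 1" by blast
  next
    fix x assume "x \<in> (+) p ` f ` cbox 0 1"
    then show "x \<in> Q" unfolding Q f_def by (fastforce simp: mem_box_cart add.assoc)
  qed
  moreover have "\<bar>det (matrix f)\<bar> = s\<^sup>2"
  proof -
    have "u $ 1 * u $ 1 + u $ 2 * u $ 2 = s\<^sup>2" "v $ 1 * v $ 1 + v $ 2 * v $ 2 = s\<^sup>2"
      using uv inner_2_distinct[of 1 2 u u] inner_2_distinct[of 1 2 v v]
      by (simp_all add: dot_square_norm)
    moreover have "u $ 1 * v $ 1 + u $ 2 * v $ 2 = 0"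
      using uv by (simp add: orthogonal_def inner_2_distinct[of 1 2])
    moreover have "det (matrix f) = u $ 1 * v $ 2 - v $ 1 * u $ 2"
      by (simp add: det_2 matrix_def f_def axis_def)
    moreover have "(u $ 1 * v $ 2 - v $ 1 * u $ 2)\<^sup>2 = (u $ 1 * u $ 1 + u $ 2 * u $ 2) * (v $ 1 * v $ 1 + v $ 2 * v $ 2)
        - (u $ 1 * v $ 1 + u $ 2 * v $ 2)\<^sup>2"
      by (simp add: power2_eq_square algebra_simps)
    ultimately have "(det (matrix f))\<^sup>2 = (s\<^sup>2)\<^sup>2" by (simp add: power2_eq_square)
    then have "det (matrix f) = s\<^sup>2 \<or> det (matrix f) = - s\<^sup>2"
      by (simp only: power2_eq_iff)
    then show ?thesis by auto
  qed
  ultimately show thesis using that lin by blast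
qed

text \<open>A square is an affine image of \<open>cbox 0 1\<close>, which gives its shape and, through the determinant, its
  area. The interior is nonempty because a convex set without interior has measure zero.\<close>

lemma solid_square_geometry:
  assumes "solid_square Q s"
  shows solid_square_convex: "convex Q" and solid_square_compact: "compact Q"
    and measure_solid_square: "measure lebesgue Q = s\<^sup>2"
    and solid_square_interior: "interior Q \<noteq> {}"
proof -
  obtain f p where f: "linear f" and Q: "Q = (+) p ` f ` cbox 0 (1::real^2)"
    and det: "\<bar>det (matrix f)\<bar> = s\<^sup>2"
    using solid_square_image[OF assms] .
  show cv: "convex Q" unfolding Q by (intro convex_translation convex_linear_image f convex_box)
  show "compact Q" unfolding Q
    using f by (intro compact_translation compact_continuous_image compact_cbox linear_continuous_on)
      (simp add: linear_conv_bounded_linear)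
  have "measure lebesgue (cbox 0 (1::real^2)) = 1"
    by (simp add: content_cbox_cart interval_ne_empty_cart)
  then show ms: "measure lebesgue Q = s\<^sup>2"
    unfolding Q using measure_linear_image[OF f, of "cbox 0 1"] det
    by (simp add: measure_translation)
  have "s > 0" using assms by (simp add: solid_square_def)
  then have "\<not> negligible Q"
    using ms negligible_imp_measure0 by fastforce
  then show "interior Q \<noteq> {}" using negligible_convex_interior[OF cv] by blast
qed

section \<open>Chords of a tilted square\<close>

lemma first_quadrant_bounds:
  fixes c d :: real
  assumes "0 \<le> c" "0 \<le> d" "c\<^sup>2 + d\<^sup>2 = 1"
  shows "c \<le> 1" "d \<le> 1" "1 \<le> c + d"
proof -
  have "c\<^sup>2 \<le> 1\<^sup>2" "d\<^sup>2 \<le> 1\<^sup>2" using assms(3) zero_le_power2[of c] zero_le_power2[of d]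
    unfolding one_power2 by linarith+
  then show "c \<le> 1" "d \<le> 1" using power2_le_imp_le[of _ 1] by simp_all
  have "(c + d)\<^sup>2 = c\<^sup>2 + d\<^sup>2 + 2 * (c * d)" by (simp add: power2_eq_square algebra_simps)
  then have "(c + d)\<^sup>2 \<ge> 1\<^sup>2" using assms by simp
  then show "1 \<le> c + d" using assms power2_le_imp_le[of 1 "c + d"] by simp
qed

lemma solid_square_width:
  assumes "solid_square Q s"
  shows "\<exists>x\<in>Q. \<exists>y\<in>Q. x $ k + s \<le> y $ k"
proof -
  obtain l where kl: "k \<noteq> l" by (metis exhaust_2 zero_neq_one)
  have s: "s > 0" using assms by (simp add: solid_square_def)
  obtain c d p where cd: "0 \<le> c" "0 \<le> d" "c\<^sup>2 + d\<^sup>2 = (1::real)"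
    and Q: "\<And>x. x \<in> Q \<longleftrightarrow> (\<exists>a\<in>{0..1}. \<exists>b\<in>{0..1}.
        x $ k = p $ k + s * (a * c - b * d) \<and> x $ l = p $ l + s * (a * d + b * c))"
    by (rule solid_square_first_quadrant[OF assms kl], rule that)
  have *: "s * d + s * c \<ge> s" using first_quadrant_bounds(3)[OF cd] mult_left_mono[of 1 "c + d" s] s by (simp add: algebra_simps)
  define x :: "real^2" where "x = (\<chi> i. if i = k then p $ k - s * d else p $ l + s * c)"
  define y :: "real^2" where "y = (\<chi> i. if i = k then p $ k + s * c else p $ l + s * d)"
  have "x \<in> Q" unfolding Q x_def using kl
    by (intro bexI[of _ 0] bexI[of _ 1]) auto
  moreover have "y \<in> Q" unfolding Q y_def using kl
    by (intro bexI[of _ 1] bexI[of _ 0]) auto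
  moreover have "x $ k + s \<le> y $ k" using * by (simp add: x_def y_def)
  ultimately show ?thesis by blast
qed

text \<open>The difference of the two sides is \<open>(1 - c) * (1 - d)\<close>. This estimate
  serves both the squares at the ends of a stack and the one in the middle.\<close>

lemma quadrant_slack:
  fixes c d :: real
  assumes "0 \<le> c" "0 \<le> d" and cd: "c\<^sup>2 + d\<^sup>2 = 1"
  shows "(1 - d) * d \<le> (c + d - 1) * c"
proof -
  have "(c + d - 1) * c - (1 - d) * d = (c\<^sup>2 + d\<^sup>2) - c - d + c * d"
    by (simp add: power2_eq_square algebra_simps)
  also have "\<dots> = (1 - c) * (1 - d)"
    unfolding cd by (simp add: algebra_simps)
  also have "\<dots> \<ge> 0" using first_quadrant_bounds[OF assms] by simp
  finally show ?thesis by simp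
qed

text \<open>For a unit square, \<open>(c - b * d, d + b * c)\<close> is a point on the edge from the rightmost to the top vertex,
  relative to the lowest vertex. The point singled out here has height exactly \<open>1\<close> over the lowest
  vertex, and its distance \<open>c - b * d + d\<close> from the vertical line through the leftmost vertex is at
  least \<open>1\<close>.\<close>

lemma core_reach:
  fixes c d :: real
  assumes cd: "0 \<le> c" "0 \<le> d" "c\<^sup>2 + d\<^sup>2 = 1"
  obtains b where "0 \<le> b" "b \<le> 1" "d + b * c = 1" "1 - d \<le> c - b * d"
proof -
  note bd = first_quadrant_bounds[OF cd]
  show thesis
  proof (cases "c = 0")
    case True
    then have "d = 1" using cd by (simp add: power2_eq_1_iff)
    then show ?thesis using that[of 0] True by simp
  next
    case False
    then have c: "c > 0" using cd by simp
    have "(1 - d) * d \<le> (c + d - 1) * c" by (rule quadrant_slack[OF cd])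
    then have "(1 - d) / c * d \<le> c + d - 1" using c by (simp add: field_simps)
    then show ?thesis using that[of "(1 - d) / c"] c bd by (simp add: field_simps)
  qed
qed

text \<open>For an axis-parallel square the upper edge lies at least \<open>s\<close> above the floor, and each of its ends
  has distance at least \<open>s\<close> from the opposite wall. A tilted square contains two points that do the same.\<close>

lemma bottom_square_core:
  assumes sq: "solid_square Q s" and kl: "k \<noteq> l"
    and Q0: "\<And>x. x \<in> Q \<Longrightarrow> x0 \<le> x $ k \<and> x $ k \<le> x1 \<and> y0 \<le> x $ l"
  obtains x y where "x \<in> Q" "y \<in> Q" "y0 + s \<le> x $ l" "y0 + s \<le> y $ l"
    "x $ k \<le> x1 - s" "x0 + s \<le> y $ k"
proof -
  have s: "s > 0" using sq by (simp add: solid_square_def)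
  obtain c d p where cd: "0 \<le> c" "0 \<le> d" "c\<^sup>2 + d\<^sup>2 = (1::real)"
    and Q: "\<And>x. x \<in> Q \<longleftrightarrow> (\<exists>a\<in>{0..1}. \<exists>b\<in>{0..1}.
        x $ k = p $ k + s * (a * c - b * d) \<and> x $ l = p $ l + s * (a * d + b * c))"
    by (rule solid_square_first_quadrant[OF sq kl], rule that)
  have dc: "d\<^sup>2 + c\<^sup>2 = 1" using cd by simp
  let ?pt = "\<lambda>a b. (\<chi> i. if i = k then p $ k + s * (a * c - b * d) else p $ l + s * (a * d + b * c)) :: real^2"
  have pt: "?pt a b \<in> Q" if "0 \<le> a" "a \<le> 1" "0 \<le> b" "b \<le> 1" for a b
    unfolding Q using kl that by (intro bexI[of _ a] bexI[of _ b]) auto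
  have left: "x0 \<le> p $ k - s * d" using Q0[OF pt[of 0 1]] by simp
  have right: "p $ k + s * c \<le> x1" and low: "y0 \<le> p $ l"
    using Q0[OF pt[of 1 0]] Q0[OF pt[of 0 0]] kl by simp_all
  obtain b where b: "0 \<le> b" "b \<le> 1" "d + b * c = 1" "1 - d \<le> c - b * d"
    using core_reach[OF cd] .
  obtain a where a: "0 \<le> a" "a \<le> 1" "c + a * d = 1" "1 - c \<le> d - a * c"
    using core_reach[OF cd(2,1) dc] .
  have "s * (1 - d) \<le> s * (c - b * d)" "s * (1 - c) \<le> s * (d - a * c)" 
    using b a s by (simp_all add: mult_left_mono)
  then have "x0 + s \<le> ?pt 1 b $ k" "?pt a 1 $ k \<le> x1 - s"
    using left right by (simp_all add: algebra_simps)
  moreover have "y0 + s \<le> ?pt 1 b $ l" "y0 + s \<le> ?pt a 1 $ l"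
    using b(3) a(3) kl low by (simp_all add: add.commute)
  ultimately show thesis using that[of "?pt a 1" "?pt 1 b"] pt a b by simp
qed

text \<open>Where to enter a square of side \<open>s\<close> from below: \<open>{m..M}\<close> is the set of admissible abscissae, measured
  from the lowest vertex, and \<open>s * (a * d + b * c)\<close> is the height lost by entering there instead of at
  that vertex. If \<open>0\<close> is admissible, the loss is zero. Otherwise the nearest admissible
  abscissa is taken, on the edge of slope \<open>d / c\<close> to the right or on the edge of slope \<open>- c / d\<close> to
  the left; the equations for the loss are multiplied out to avoid the division.\<close>

lemma bottom_reach:
  fixes c d s m M :: real
  assumes cd: "0 \<le> c" "0 \<le> d" and s: "s > 0"
    and m: "m \<le> M" "m \<le> s * c" "- s * d \<le> M"
  obtains a b where "a \<in> {0..1}" "b \<in> {0..1}" "m \<le> s * (a * c - b * d)" "s * (a * c - b * d) \<le> M"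
    "s * (a * d + b * c) = 0 \<or> 0 < m \<and> s * (a * d + b * c) * c = m * d \<or>
     M < 0 \<and> s * (a * d + b * c) * d = - M * c"
proof -
  consider "m \<le> 0" "0 \<le> M" | "0 < m" | "M < 0" by linarith
  then show thesis
  proof cases
    case 1 then show ?thesis using that[of 0 0] by simp
  next
    case 2
    then have "0 < s * c" using m by linarith
    then have "c > 0" using s by (simp add: zero_less_mult_iff)
    then show ?thesis using that[of "m / (s * c)" 0] 2 m s by (simp add: field_simps)
  next
    case 3
    then have "0 < s * d" using m by linarith
    then have "d > 0" using s by (simp add: zero_less_mult_iff)
    then show ?thesis using that[of 0 "- M / (s * d)"] 3 m s by (simp add: field_simps)
  qed
qed

text \<open>A horizontal offset \<open>D\<close> along an edge of slope \<open>d / c\<close> costs the height \<open>e = D * d / c\<close>. Up to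
  \<open>D = s * (1 - d)\<close> this is covered by the surplus \<open>s * (c + d) - s\<close> of the height of a tilted square
  over its side.\<close>

lemma edge_loss_le:
  fixes c d s D e :: real
  assumes cd: "0 \<le> c" "0 \<le> d" "c\<^sup>2 + d\<^sup>2 = 1" and s: "s > 0" and c: "c > 0"
    and e: "e * c = D * d" and D: "D \<le> s * (1 - d)"
  shows "e \<le> s * (c + d - 1)"
proof -
  note bd = first_quadrant_bounds[OF cd]
  have "s * ((1 - d) * d) \<le> s * ((c + d - 1) * c)" using quadrant_slack[OF cd] s by simp
  moreover have "D * d \<le> s * (1 - d) * d" using D cd by (simp add: mult_right_mono)
  ultimately have "e * c \<le> s * (c + d - 1) * c" using e by (simp add: algebra_simps)
  then show ?thesis using c by simp
qed

text \<open>The intervals \<open>{lA..rA}\<close> and \<open>{lC..rC}\<close> are the abscissae at which a square below and a square above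
  can be left and entered. Crossing \<open>Q\<close> from its lowest to its highest vertex would gain the height
  \<open>s * (c + d)\<close>. If an end of this crossing lies outside its interval, it is shifted to the nearest
  admissible abscissa, at some loss of height.

  Shifting both ends in the same direction is impossible: if \<open>lA\<close> is right of the lowest
  and \<open>lC\<close> right of the highest vertex, then \<open>lA + lC\<close> exceeds \<open>2 * x0 + s * (c + d)\<close>, which is at least
  \<open>2 * x0 + s\<close>, whereas \<open>lA + lC \<le> 2 * x1 - sA - sC < 2 * x0 + s\<close>. If the ends are shifted in
  opposite directions, or only one end is shifted, then the edges concerned are parallel and the
  offsets add up to at most \<open>s * (1 - d)\<close>, or \<open>s * (1 - c)\<close>, so that the surplus covers the loss.\<close>

lemma middle_square_crossing:
  assumes sq: "solid_square Q s" and kl: "k \<noteq> l"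
    and Q0: "\<And>x. x \<in> Q \<Longrightarrow> x0 \<le> x $ k \<and> x $ k \<le> x1"
    and A: "lA \<le> rA" "lA \<le> x1 - sA" "x0 + sA \<le> rA" "sA \<le> x1 - x0"
    and C: "lC \<le> rC" "lC \<le> x1 - sC" "x0 + sC \<le> rC" "sC \<le> x1 - x0"
    and sum: "2 * (x1 - x0) < sA + s + sC"
  obtains x y where "x \<in> Q" "y \<in> Q" "x $ k \<in> {lA..rA}" "y $ k \<in> {lC..rC}" "x $ l + s \<le> y $ l"
proof -
  have s: "s > 0" using sq by (simp add: solid_square_def)
  obtain c d p where cd: "0 \<le> c" "0 \<le> d" "c\<^sup>2 + d\<^sup>2 = (1::real)"
    and Q: "\<And>x. x \<in> Q \<longleftrightarrow> (\<exists>a\<in>{0..1}. \<exists>b\<in>{0..1}.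
        x $ k = p $ k + s * (a * c - b * d) \<and> x $ l = p $ l + s * (a * d + b * c))"
    by (rule solid_square_first_quadrant[OF sq kl], rule that)
  have dc: "d\<^sup>2 + c\<^sup>2 = 1" using cd by simp
  note bd = first_quadrant_bounds[OF cd]
  let ?pt = "\<lambda>a b. (\<chi> i. if i = k then p $ k + s * (a * c - b * d) else p $ l + s * (a * d + b * c)) :: real^2"
  have pt: "?pt a b \<in> Q" if "0 \<le> a" "a \<le> 1" "0 \<le> b" "b \<le> 1" for a b
    unfolding Q using kl that by (intro bexI[of _ a] bexI[of _ b]) auto
  have left: "x0 \<le> p $ k - s * d" and right: "p $ k + s * c \<le> x1"
    using Q0[OF pt[of 0 1]] Q0[OF pt[of 1 0]] kl by simp_all
  define t where "t = p $ k + s * (c - d)"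
  have t: "t = p $ k + s * c - s * d" by (simp add: t_def algebra_simps)
  have sc: "s * c \<le> s" "s * d \<le> s" "0 \<le> s * c" "0 \<le> s * d" "s \<le> s * c + s * d"
    using s bd cd mult_left_mono[of 1 "c + d" s] by (simp_all add: algebra_simps)
  \<comment> \<open>The lower end, at offset \<open>s * (a * c - b * d)\<close> from the lowest vertex.\<close>
  obtain a b where ab: "a \<in> {0..1}" "b \<in> {0..1}"
    and abk: "lA - p $ k \<le> s * (a * c - b * d)" "s * (a * c - b * d) \<le> rA - p $ k"
    and abl: "s * (a * d + b * c) = 0 \<or> 0 < lA - p $ k \<and> s * (a * d + b * c) * c = (lA - p $ k) * d \<or>
     rA - p $ k < 0 \<and> s * (a * d + b * c) * d = - (rA - p $ k) * c"
    by (rule bottom_reach[OF cd(1,2) s, of "lA - p $ k" "rA - p $ k"])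
      (use A C sum left right sc in auto)
  \<comment> \<open>The upper end is the lower end of the square turned by a half turn, and \<open>t\<close> is the abscissa of the highest vertex.\<close>
  obtain a' b' where ab': "a' \<in> {0..1}" "b' \<in> {0..1}"
    and abk': "t - rC \<le> s * (a' * c - b' * d)" "s * (a' * c - b' * d) \<le> t - lC"
    and abl': "s * (a' * d + b' * c) = 0 \<or> 0 < t - rC \<and> s * (a' * d + b' * c) * c = (t - rC) * d \<or>
     t - lC < 0 \<and> s * (a' * d + b' * c) * d = - (t - lC) * c"
    by (rule bottom_reach[OF cd(1,2) s, of "t - rC" "t - lC"])
      (use A C sum left right sc t in auto)
  let ?e = "s * (a * d + b * c)" and ?e' = "s * (a' * d + b' * c)"
  note loss = edge_loss_le[OF cd s] edge_loss_le[OF cd(2,1) dc s]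
  have s1: "s * (1 - d) = s - s * d" "s * (1 - c) = s - s * c" by (simp_all add: algebra_simps)
  have pos: "c > 0" if "0 < lA - p $ k \<or> 0 < t - rC"
  proof (rule ccontr)
    assume "\<not> c > 0"
    then have "c = 0" "d = 1" using cd bd by auto
    then show False using that A C sum left right t by auto
  qed
  have pos': "d > 0" if "rA - p $ k < 0 \<or> t - lC < 0"
  proof (rule ccontr)
    assume "\<not> d > 0"
    then have "d = 0" "c = 1" using cd bd by auto
    then show False using that A C sum left right t by auto
  qed
  have "?e + ?e' \<le> s * (c + d - 1)"
    using abl
  proof (elim disjE conjE)
    assume e: "?e = 0"
    show ?thesis using abl'
    proof (elim disjE conjE)
      assume "?e' = 0" then show ?thesis using e s bd by simp
    next
      assume "0 < t - rC" "?e' * c = (t - rC) * d"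
      then show ?thesis using e pos A C sum left right sc t s1 by (intro loss(1)) auto
    next
      assume "t - lC < 0" "?e' * d = - (t - lC) * c"
      then show ?thesis using e pos' A C sum left right sc t s1 loss(2)[of ?e' "lC - t"] by (simp add: add.commute)
    qed
  next
    assume e: "0 < lA - p $ k" "?e * c = (lA - p $ k) * d"
    show ?thesis using abl'
    proof (elim disjE conjE)
      assume "?e' = 0" then show ?thesis
        using e pos A C sum left right sc t s1 loss(1)[of ?e "lA - p $ k"] by simp
    next
      assume e': "0 < t - rC" "?e' * c = (t - rC) * d"
      then have "(?e + ?e') * c = (lA - p $ k + (t - rC)) * d" using e by (simp add: distrib_right)
      then show ?thesis using e e' pos A C sum left right sc t s1 by (intro loss(1)) auto
    next
      assume "t - lC < 0"
      then have False using e(1) A C sum left right sc t by argo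
      then show ?thesis ..
    qed
  next
    assume e: "rA - p $ k < 0" "?e * d = - (rA - p $ k) * c"
    show ?thesis using abl'
    proof (elim disjE conjE)
      assume "?e' = 0" then show ?thesis
        using e pos' A C sum left right sc t s1 loss(2)[of ?e "- (rA - p $ k)"] by (simp add: add.commute)
    next
      assume "0 < t - rC"
      then have False using e(1) A C sum left right sc t by argo
      then show ?thesis ..
    next
      assume e': "t - lC < 0" "?e' * d = - (t - lC) * c"
      then have "(?e + ?e') * d = (- (rA - p $ k) + - (t - lC)) * c" using e by (simp add: distrib_right)
      then have "?e + ?e' \<le> s * (d + c - 1)"
        using e e' pos' A C sum left right sc t s1 by (intro loss(2)) auto
      then show ?thesis by (simp add: add.commute)
    qed
  qed
  then have "?pt a b $ l + s \<le> ?pt (1 - a') (1 - b') $ l"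
    using kl by (simp add: algebra_simps)
  moreover have "?pt a b $ k \<in> {lA..rA}" "?pt (1 - a') (1 - b') $ k \<in> {lC..rC}"
    using abk abk' unfolding t_def by (simp_all add: algebra_simps)
  ultimately show thesis
    using that[OF pt pt, of a b "1 - a'" "1 - b'"] ab ab' by simp
qed

section \<open>Order along vertical lines\<close>

definition below :: "2 \<Rightarrow> 2 \<Rightarrow> (real^2) set \<Rightarrow> (real^2) set \<Rightarrow> bool" where
  "below k l A B \<longleftrightarrow> (\<forall>x\<in>A. \<forall>y\<in>B. x $ k = y $ k \<longrightarrow> x $ l \<le> y $ l)"

text \<open>The packing hypotheses only speak of interiors. As a square is the closure of its interior, what is
  known about the interior passes to the whole square.\<close>

lemma subset_closed_if_interior_subset:
  assumes "solid_square Q s" and "closed H" and "interior Q \<subseteq> H"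
  shows "Q \<subseteq> H"
proof -
  have "Q \<subseteq> closure (interior Q)"
    using convex_closure_interior[OF solid_square_convex solid_square_interior] assms(1) closure_subset
    by metis
  also have "\<dots> \<subseteq> H" using assms(2,3) by (rule closure_minimal[rotated])
  finally show ?thesis .
qed

lemma squares_separated:
  assumes A: "solid_square A sA" and B: "solid_square B sB" and disj: "interior A \<inter> interior B = {}"
  obtains n b where "n \<noteq> 0" "\<And>x. x \<in> A \<Longrightarrow> n \<bullet> x \<le> b" "\<And>x. x \<in> B \<Longrightarrow> b \<le> n \<bullet> x"
proof -
  obtain n b where n: "n \<noteq> 0" "\<forall>x\<in>interior A. n \<bullet> x \<le> b" "\<forall>x\<in>interior B. b \<le> n \<bullet> x"
    using separating_hyperplane_sets[of "interior A" "interior B"] A B disj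
    by (metis convex_interior solid_square_convex solid_square_interior)
  have "A \<subseteq> {x. n \<bullet> x \<le> b}"
    using n(2) by (intro subset_closed_if_interior_subset[OF A] closed_halfspace_le) blast
  moreover have "B \<subseteq> {x. n \<bullet> x \<ge> b}"
    using n(3) by (intro subset_closed_if_interior_subset[OF B] closed_halfspace_ge) blast
  ultimately show thesis using that n(1) by blast
qed

text \<open>A vertical separating line would put the two squares side by side, which takes the
  width \<open>sA + sB\<close>. Along a vertical line, any other separating line splits the points of the two
  squares into upper and lower ones, the same way for all vertical lines.\<close>

lemma below_total:
  assumes kl: "k \<noteq> l" and A: "solid_square A sA" and B: "solid_square B sB"
    and disj: "interior A \<inter> interior B = {}"
    and strip: "A \<union> B \<subseteq> {x. x0 \<le> x $ k \<and> x $ k \<le> x1}" and wide: "x1 - x0 < sA + sB"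
  shows "below k l A B \<or> below k l B A"
proof -
  obtain n b where n: "n \<noteq> 0" "\<And>x. x \<in> A \<Longrightarrow> n \<bullet> x \<le> b" "\<And>x. x \<in> B \<Longrightarrow> b \<le> n \<bullet> x"
    by (rule squares_separated[OF A B disj], rule that)
  have order: "n $ k * x $ k + n $ l * x $ l \<le> n $ k * y $ k + n $ l * y $ l"
    if "x \<in> A" "y \<in> B" for x y
    using n(2)[OF that(1)] n(3)[OF that(2)] by (simp add: inner_2_distinct[OF kl])
  consider "n $ l > 0" | "n $ l < 0" | "n $ l = 0" by linarith
  then show ?thesis
  proof cases
    case 1
    then have "below k l A B" unfolding below_def using order by fastforce
    then show ?thesis ..
  next
    case 2
    have "below k l B A" unfolding below_def
    proof (intro ballI impI)
      fix y x assume "y \<in> B" "x \<in> A" "y $ k = x $ k"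
      then have "n $ l * x $ l \<le> n $ l * y $ l" using order[of x y] by simp
      then show "y $ l \<le> x $ l" using 2 by simp
    qed
    then show ?thesis ..
  next
    case 3
    then have nk: "n $ k \<noteq> 0" using n(1) vec_2_eq[OF kl, of n 0] by simp
    obtain a a' where a: "a \<in> A" "a' \<in> A" "a $ k + sA \<le> a' $ k"
      using solid_square_width[OF A] by blast
    obtain b b' where b: "b \<in> B" "b' \<in> B" "b $ k + sB \<le> b' $ k"
      using solid_square_width[OF B] by blast
    have *: "x0 \<le> a $ k" "x0 \<le> b $ k" "a' $ k \<le> x1" "b' $ k \<le> x1"
      using a b strip by auto
    show ?thesis
    proof (cases "n $ k > 0")
      case True
      then have "a' $ k \<le> b $ k" using order[of a' b] a b 3 by simp
      then show ?thesis using a b * wide by linarith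
    next
      case False
      then have "b' $ k \<le> a $ k" using order[of a b'] a b 3 nk by simp
      then show ?thesis using a b * wide by linarith
    qed
  qed
qed

section \<open>Two, three and four squares in a rectangle\<close>

definition rectangle :: "2 \<Rightarrow> 2 \<Rightarrow> real \<Rightarrow> real \<Rightarrow> real \<Rightarrow> real \<Rightarrow> (real^2) set" where
  "rectangle k l x0 x1 y0 y1 = {x. x0 \<le> x $ k \<and> x $ k \<le> x1 \<and> y0 \<le> x $ l \<and> x $ l \<le> y1}"

lemma square_in_rectangle_le:
  assumes "solid_square Q s" "Q \<subseteq> rectangle k l x0 x1 y0 y1"
  shows "s \<le> x1 - x0"
proof -
  obtain x y where "x \<in> Q" "y \<in> Q" "x $ k + s \<le> y $ k"
    using solid_square_width[OF assms(1)] by blast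
  moreover have "x0 \<le> x $ k \<and> x $ k \<le> x1" if "x \<in> Q" for x
    using that assms(2) by (auto simp: rectangle_def)
  ultimately have "x0 \<le> x $ k" "y $ k \<le> x1" "x $ k + s \<le> y $ k" by blast+
  then show ?thesis by linarith
qed

lemma square_slice_interval:
  assumes Q: "solid_square Q s" and H: "convex H"
    and xy: "x \<in> Q" "y \<in> Q" "x \<in> H" "y \<in> H" and t: "x $ k \<le> t" "t \<le> y $ k"
  obtains z where "z \<in> Q" "z \<in> H" "z $ k = t"
proof -
  have "connected (Q \<inter> H)"
    by (intro convex_connected convex_Int solid_square_convex[OF Q] H)
  then show thesis
    using connected_ivt_component_cart[of "Q \<inter> H" x y k t] xy t that by auto
qed

text \<open>The part of the square at height at least \<open>s\<close> over the floor is convex, so it projects onto an interval,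
  and this interval contains the abscissae of the two points of \<open>bottom_square_core\<close>.\<close>

lemma bottom_square_interval:
  assumes kl: "k \<noteq> l" and Q: "solid_square Q s" and R: "Q \<subseteq> rectangle k l x0 x1 y0 y1"
  obtains lo hi where "lo \<le> x1 - s" "x0 + s \<le> hi" "lo \<le> hi"
    "\<And>t. t \<in> {lo..hi} \<Longrightarrow> \<exists>z\<in>Q. z $ k = t \<and> y0 + s \<le> z $ l"
proof -
  obtain x y where xy: "x \<in> Q" "y \<in> Q" "y0 + s \<le> x $ l" "y0 + s \<le> y $ l"
    "x $ k \<le> x1 - s" "x0 + s \<le> y $ k"
    by (rule bottom_square_core[OF Q kl, of x0 x1 y0]) (use R in \<open>auto simp: rectangle_def\<close>)
  have H: "convex {z. y0 + s \<le> z $ l}"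
    using convex_halfspace_ge[of "y0 + s" "axis l (1::real)"] by (simp add: inner_axis' inner_real_def)
  have between: "\<exists>z\<in>Q. z $ k = t \<and> y0 + s \<le> z $ l"
    if uv: "{u, v} = {x, y}" and t: "u $ k \<le> t" "t \<le> v $ k" for u v t
  proof -
    have "u \<in> Q" "v \<in> Q" "y0 + s \<le> u $ l" "y0 + s \<le> v $ l" using uv xy by (auto simp: doubleton_eq_iff)
    then show ?thesis using square_slice_interval[OF Q H _ _ _ _ t] by blast
  qed
  show thesis
  proof (rule that[of "min (x $ k) (y $ k)" "max (x $ k) (y $ k)"])
    fix t assume "t \<in> {min (x $ k) (y $ k)..max (x $ k) (y $ k)}"
    then have "x $ k \<le> t \<and> t \<le> y $ k \<or> y $ k \<le> t \<and> t \<le> x $ k" by auto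
    then show "\<exists>z\<in>Q. z $ k = t \<and> y0 + s \<le> z $ l"
      using between[of x y t] between[of y x t] by auto
  qed (use xy in auto)
qed

text \<open>The previous lemma for the square turned by a half turn.\<close>

lemma top_square_interval:
  assumes kl: "k \<noteq> l" and Q: "solid_square Q s" and R: "Q \<subseteq> rectangle k l x0 x1 y0 y1"
  obtains lo hi where "lo \<le> x1 - s" "x0 + s \<le> hi" "lo \<le> hi"
    "\<And>t. t \<in> {lo..hi} \<Longrightarrow> \<exists>z\<in>Q. z $ k = t \<and> z $ l \<le> y1 - s"
proof -
  have R': "uminus ` Q \<subseteq> rectangle k l (- x1) (- x0) (- y1) (- y0)"
    using R by (auto simp: rectangle_def)
  obtain lo hi where lh: "lo \<le> - x0 - s" "- x1 + s \<le> hi" "lo \<le> hi"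
    "\<And>t. t \<in> {lo..hi} \<Longrightarrow> \<exists>z\<in>uminus ` Q. z $ k = t \<and> - y1 + s \<le> z $ l"
    using bottom_square_interval[OF kl solid_square_uminus[OF Q] R'] by blast
  show thesis
  proof (rule that[of "- hi" "- lo"])
    fix t assume "t \<in> {- hi..- lo}"
    then have "- t \<in> {lo..hi}" by auto
    then obtain z where "z \<in> Q" "(- z) $ k = - t" "- y1 + s \<le> (- z) $ l"
      using lh(4) by blast
    then show "\<exists>z\<in>Q. z $ k = t \<and> z $ l \<le> y1 - s" by (intro bexI[of _ z]) auto
  qed (use lh in auto)
qed

lemma two_stacked_squares:
  assumes kl: "k \<noteq> l" and A: "solid_square A sA" "A \<subseteq> rectangle k l x0 x1 y0 y1"
    and B: "solid_square B sB" "B \<subseteq> rectangle k l x0 x1 y0 y1"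
    and ord: "below k l A B" and wide: "x1 - x0 < sA + sB"
  shows "sA + sB \<le> y1 - y0"
proof -
  obtain lA hA where IA: "lA \<le> x1 - sA" "x0 + sA \<le> hA" "lA \<le> hA"
    "\<And>t. t \<in> {lA..hA} \<Longrightarrow> \<exists>z\<in>A. z $ k = t \<and> y0 + sA \<le> z $ l"
    using bottom_square_interval[OF kl A] by blast
  obtain lB hB where IB: "lB \<le> x1 - sB" "x0 + sB \<le> hB" "lB \<le> hB"
    "\<And>t. t \<in> {lB..hB} \<Longrightarrow> \<exists>z\<in>B. z $ k = t \<and> z $ l \<le> y1 - sB"
    using top_square_interval[OF kl B] by blast
  have "max lA lB \<in> {lA..hA}" "max lA lB \<in> {lB..hB}" using IA(1-3) IB(1-3) wide by auto
  then obtain a b where "a \<in> A" "b \<in> B" "a $ k = b $ k" "y0 + sA \<le> a $ l" "b $ l \<le> y1 - sB"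
    using IA(4) IB(4) by metis
  moreover have "a $ l \<le> b $ l" if "a \<in> A" "b \<in> B" "a $ k = b $ k" for a b
    using ord that unfolding below_def by blast
  ultimately show ?thesis by force
qed

lemma three_stacked_squares:
  assumes kl: "k \<noteq> l" and A: "solid_square A sA" "A \<subseteq> rectangle k l x0 x1 y0 y1"
    and B: "solid_square B sB" "B \<subseteq> rectangle k l x0 x1 y0 y1"
    and C: "solid_square C sC" "C \<subseteq> rectangle k l x0 x1 y0 y1"
    and ord: "below k l A B" "below k l B C" and wide: "2 * (x1 - x0) < sA + sB + sC"
  shows "sA + sB + sC \<le> y1 - y0"
proof -
  obtain lA hA where IA: "lA \<le> x1 - sA" "x0 + sA \<le> hA" "lA \<le> hA"
    "\<And>t. t \<in> {lA..hA} \<Longrightarrow> \<exists>z\<in>A. z $ k = t \<and> y0 + sA \<le> z $ l"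
    using bottom_square_interval[OF kl A] by blast
  obtain lC hC where IC: "lC \<le> x1 - sC" "x0 + sC \<le> hC" "lC \<le> hC"
    "\<And>t. t \<in> {lC..hC} \<Longrightarrow> \<exists>z\<in>C. z $ k = t \<and> z $ l \<le> y1 - sC"
    using top_square_interval[OF kl C] by blast
  have strip: "x0 \<le> x $ k \<and> x $ k \<le> x1" if "x \<in> B" for x
    using that B(2) by (auto simp: rectangle_def)
  obtain x y where xy: "x \<in> B" "y \<in> B" "x $ k \<in> {lA..hA}" "y $ k \<in> {lC..hC}" "x $ l + sB \<le> y $ l"
    using middle_square_crossing[OF B(1) kl strip IA(3,1,2) square_in_rectangle_le[OF A]
      IC(3,1,2) square_in_rectangle_le[OF C] wide] by blast
  obtain a where a: "a \<in> A" "a $ k = x $ k" "y0 + sA \<le> a $ l" using IA(4) xy(3) by blast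
  obtain c where c: "c \<in> C" "c $ k = y $ k" "c $ l \<le> y1 - sC" using IC(4) xy(4) by blast
  have "a $ l \<le> x $ l" "y $ l \<le> c $ l" using ord a c xy unfolding below_def by auto
  then show ?thesis using a c xy by linarith
qed

text \<open>A packing as in \<open>square_packing\<close>, but into an arbitrary container.\<close>

definition packed_in :: "(real^2) set \<Rightarrow> 'i set \<Rightarrow> ('i \<Rightarrow> (real^2) set) \<Rightarrow> ('i \<Rightarrow> real) \<Rightarrow> bool" where
  "packed_in R I Q s \<longleftrightarrow>
     (\<forall>i\<in>I. solid_square (Q i) (s i) \<and> Q i \<subseteq> R) \<and>
     (\<forall>i\<in>I. \<forall>j\<in>I. i \<noteq> j \<longrightarrow> interior (Q i) \<inter> interior (Q j) = {})"

lemma packed_below_total: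
  assumes kl: "k \<noteq> l" and P: "packed_in (rectangle k l x0 x1 y0 y1) I Q s"
    and ij: "i \<in> I" "j \<in> I" "i \<noteq> j" and wide: "x1 - x0 < s i + s j"
  shows "below k l (Q i) (Q j) \<or> below k l (Q j) (Q i)"
  using P ij by (intro below_total[OF kl _ _ _ _ wide]) (auto simp: packed_in_def rectangle_def)

lemma two_squares_in_rectangle:
  assumes kl: "k \<noteq> l" and P: "packed_in (rectangle k l x0 x1 y0 y1) I Q s" and I: "card I = 2"
  shows "sum s I \<le> max (x1 - x0) (y1 - y0)"
proof (rule ccontr)
  obtain i j where ij: "I = {i, j}" "i \<noteq> j" using I by (auto simp: card_2_iff)
  assume "\<not> ?thesis"
  then have "x1 - x0 < s i + s j" "y1 - y0 < s i + s j" using ij by auto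
  then show False
    using packed_below_total[OF kl P, of i j] ij P two_stacked_squares[OF kl, of "Q i" "s i" x0 x1 y0 y1 "Q j" "s j"]
      two_stacked_squares[OF kl, of "Q j" "s j" x0 x1 y0 y1 "Q i" "s i"]
    by (auto simp: packed_in_def)
qed

text \<open>For each of the six orders of the squares, \<open>three_stacked_squares\<close> forbids a chain; but comparing
  any two of three squares always produces one. Cyclic comparisons do no harm, since a cycle contains
  a chain as well.\<close>

lemma three_squares_in_rectangle:
  assumes kl: "k \<noteq> l" and P: "packed_in (rectangle k l x0 x1 y0 y1) I Q s" and I: "card I = 3"
  shows "sum s I \<le> max (2 * (x1 - x0)) (y1 - y0)"
proof (rule ccontr)
  obtain a b c where abc: "I = {a, b, c}" "a \<noteq> b" "b \<noteq> c" "a \<noteq> c"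
    using I by (auto simp: card_3_iff)
  assume "\<not> ?thesis"
  then have big: "2 * (x1 - x0) < s a + s b + s c" "y1 - y0 < s a + s b + s c"
    using abc by auto
  have sq: "solid_square (Q i) (s i)" "Q i \<subseteq> rectangle k l x0 x1 y0 y1" if "i \<in> I" for i
    using P that by (auto simp: packed_in_def)
  have "s i \<le> x1 - x0" if "i \<in> I" for i
    using square_in_rectangle_le[OF sq[OF that]] .
  then have "s a \<le> x1 - x0" "s b \<le> x1 - x0" "s c \<le> x1 - x0" using abc by auto
  then have wide: "x1 - x0 < s a + s b" "x1 - x0 < s b + s c" "x1 - x0 < s a + s c"
    using big(1) by argo+
  let ?below = "\<lambda>i j. below k l (Q i) (Q j)"
  have no_chain: "\<not> (?below i j \<and> ?below j m)" if "{i, j, m} = I" "s i + s j + s m = s a + s b + s c" for i j m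
    using three_stacked_squares[OF kl sq sq sq, of i j m] that big by auto
  have "?below a b \<or> ?below b a" "?below b c \<or> ?below c b" "?below a c \<or> ?below c a"
    using packed_below_total[OF kl P] abc wide by simp_all
  then show False
    using no_chain[of a b c] no_chain[of a c b] no_chain[of b a c] no_chain[of b c a]
      no_chain[of c a b] no_chain[of c b a] abc(1)
    by (auto simp: insert_commute)
qed

lemma measure_rectangle:
  assumes kl: "k \<noteq> l" and "x0 \<le> x1" "y0 \<le> y1"
  shows "rectangle k l x0 x1 y0 y1 \<in> lmeasurable"
    "measure lebesgue (rectangle k l x0 x1 y0 y1) = (x1 - x0) * (y1 - y0)"
proof -
  let ?a = "\<chi> i. if i = k then x0 else y0" and ?b = "\<chi> i. if i = k then x1 else y1"
  have all: "(\<forall>i. P i) \<longleftrightarrow> P k \<and> P l" for P :: "2 \<Rightarrow> bool"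
    unfolding ball_UNIV[symmetric] UNIV_2_distinct[OF kl] by simp
  have R: "rectangle k l x0 x1 y0 y1 = cbox ?a ?b"
    using kl by (auto simp: rectangle_def mem_box_cart all)
  then show "rectangle k l x0 x1 y0 y1 \<in> lmeasurable" by simp
  have "cbox ?a ?b \<noteq> {}" using assms by (simp add: interval_ne_empty_cart)
  then show "measure lebesgue (rectangle k l x0 x1 y0 y1) = (x1 - x0) * (y1 - y0)"
    unfolding R using kl by (simp add: content_cbox_cart UNIV_2_distinct[OF kl])
qed

text \<open>The interiors are disjoint and have full measure, because the frontier of a convex set is negligible.\<close>

lemma packed_area_le:
  assumes fin: "finite I" and P: "packed_in R I Q s" and R: "R \<in> lmeasurable"
  shows "(\<Sum>i\<in>I. (s i)\<^sup>2) \<le> measure lebesgue R"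
proof -
  have sq: "solid_square (Q i) (s i)" "Q i \<subseteq> R" if "i \<in> I" for i
    using P that by (auto simp: packed_in_def)
  have meas: "interior (Q i) \<in> lmeasurable" "measure lebesgue (interior (Q i)) = (s i)\<^sup>2" if "i \<in> I" for i
  proof -
    note Q = sq(1)[OF that]
    have bounded: "bounded (Q i)" using solid_square_compact[OF Q] by (rule compact_imp_bounded)
    then show "interior (Q i) \<in> lmeasurable" by (rule lmeasurable_interior)
    show "measure lebesgue (interior (Q i)) = (s i)\<^sup>2"
      using measure_interior[OF bounded negligible_convex_frontier[OF solid_square_convex[OF Q]]]
        measure_solid_square[OF Q] by simp
  qed
  have "(\<Sum>i\<in>I. (s i)\<^sup>2) = (\<Sum>i\<in>I. measure lebesgue (interior (Q i)))"
    using meas by simp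
  also have "\<dots> = measure lebesgue (\<Union>i\<in>I. interior (Q i))"
  proof (rule measure_finite_Union[symmetric])
    show "(\<lambda>i. interior (Q i)) ` I \<subseteq> sets lebesgue" using fmeasurableD[OF meas(1)] by blast
    show "disjoint_family_on (\<lambda>i. interior (Q i)) I"
      using P by (auto simp: disjoint_family_on_def packed_in_def)
    show "emeasure lebesgue (interior (Q i)) \<noteq> \<infinity>" if "i \<in> I" for i
      using fmeasurableD2[OF meas(1)[OF that]] by simp
  qed (rule fin)
  also have "\<dots> \<le> measure lebesgue R"
  proof (rule measure_mono_fmeasurable)
    show "(\<Union>i\<in>I. interior (Q i)) \<subseteq> R" using sq(2) interior_subset by fast
    show "(\<Union>i\<in>I. interior (Q i)) \<in> sets lebesgue"
      using fin meas by (auto simp: fmeasurable_def)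
  qed (rule R)
  finally show ?thesis .
qed

lemma four_squares_in_rectangle:
  assumes kl: "k \<noteq> l" and P: "packed_in (rectangle k l x0 x1 y0 y1) I Q s" and I: "card I = 4"
    and "x0 \<le> x1" "y0 \<le> y1"
  shows "sum s I \<le> (x1 - x0) + (y1 - y0)"
proof -
  have fin: "finite I" using I by (simp add: card_ge_0_finite)
  have "(sum s I)\<^sup>2 \<le> (\<Sum>i\<in>I. (s i)\<^sup>2) * card I"
    by (rule sum_squared_le_sum_of_squares)
  also have "\<dots> \<le> (x1 - x0) * (y1 - y0) * 4"
    using packed_area_le[OF fin P measure_rectangle(1)] measure_rectangle(2) assms by simp
  also have "\<dots> \<le> ((x1 - x0) + (y1 - y0))\<^sup>2"
    using zero_le_power2[of "(x1 - x0) - (y1 - y0)"] by (simp add: power2_eq_square algebra_simps)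
  finally show ?thesis by (rule power2_le_imp_le) (use assms(4,5) in simp)
qed

section \<open>Cutting the unit square\<close>

text \<open>The interior is connected, so a line that misses it cannot have parts of it on both sides.\<close>

lemma square_on_one_side:
  assumes Q: "solid_square Q s" and cut: "{x. x $ k = c} \<inter> interior Q = {}"
  shows "Q \<subseteq> {x. x $ k \<le> c} \<or> Q \<subseteq> {x. x $ k \<ge> c}"
proof -
  have conn: "connected (interior Q)"
    using solid_square_convex[OF Q] by (simp add: convex_connected)
  have "interior Q \<subseteq> {x. x $ k \<le> c} \<or> interior Q \<subseteq> {x. x $ k \<ge> c}"
  proof (rule ccontr)
    assume "\<not> ?thesis"
    then obtain x y where xy: "x \<in> interior Q" "y \<in> interior Q" "x $ k < c" "c < y $ k" by force
    then show False using connected_ivt_component_cart[OF conn, of x y k c] cut by auto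
  qed
  then show ?thesis
    using subset_closed_if_interior_subset[OF Q]
    by (metis closed_halfspace_component_le_cart closed_halfspace_component_ge_cart)
qed

theorem corollary11:
  fixes Q :: "nat \<Rightarrow> (real^2) set" and s :: "nat \<Rightarrow> real"
  assumes "square_packing {1..5} Q s"
    and "\<exists>k c. axis_guillotine_cut {1..5} Q k c"
  shows "(\<Sum>i=1..5. s i) \<le> 2"
proof -
  obtain k c where cut: "axis_guillotine_cut {1..5} Q k c" using assms(2) by blast
  obtain l where kl: "k \<noteq> l" by (metis exhaust_2 zero_neq_one)
  have sq: "solid_square (Q i) (s i)" "Q i \<subseteq> unit_square" if "i \<in> {1..5}" for i
    using assms(1) that by (auto simp: square_packing_def)
  have disj: "interior (Q i) \<inter> interior (Q j) = {}" if "i \<in> {1..5}" "j \<in> {1..5}" "i \<noteq> j" for i j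
    using assms(1) that by (auto simp: square_packing_def)
  define L where "L = {i \<in> {1..5}. Q i \<subseteq> {x. x $ k \<le> c}}"
  define R where "R = {1..5} - L"
  have R_ge: "Q i \<subseteq> {x. x $ k \<ge> c}" if "i \<in> R" for i
    using square_on_one_side[OF sq(1), of i k c] cut that
    by (auto simp: R_def L_def axis_guillotine_cut_def)
  have unit: "0 \<le> x $ m \<and> x $ m \<le> 1" if "i \<in> {1..5}" "x \<in> Q i" for i x m
    using sq(2)[OF that(1)] that(2) unfolding unit_square_def by blast
  have packed: "packed_in A J Q s" if "J \<subseteq> {1..5}" "\<And>i. i \<in> J \<Longrightarrow> Q i \<subseteq> A" for J A
    using that sq(1) disj unfolding packed_in_def by (meson subsetD)
  have PL: "packed_in (rectangle k l 0 c 0 1) L Q s"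
    using unit by (intro packed) (auto simp: L_def rectangle_def)
  have PR: "packed_in (rectangle k l c 1 0 1) R Q s"
    using unit R_ge by (intro packed) (fastforce simp: R_def rectangle_def)+
  have side: "s i \<le> w" if "packed_in (rectangle k l a b 0 1) J Q s" "i \<in> J" "w = b - a" for i w a b J
    using that square_in_rectangle_le by (auto simp: packed_in_def)
  have "L \<noteq> {}" using cut by (auto simp: axis_guillotine_cut_def L_def)
  \<comment> \<open>A square on the far side of the line is not also counted in \<open>L\<close>, because it has positive width.\<close>
  moreover have "R \<noteq> {}"
  proof -
    obtain i where i: "i \<in> {1..5}" "Q i \<subseteq> {x. x $ k \<ge> c}"
      using cut by (auto simp: axis_guillotine_cut_def)
    obtain x y where xy: "x \<in> Q i" "y \<in> Q i" "x $ k + s i \<le> y $ k"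
      using solid_square_width[OF sq(1)[OF i(1)]] by blast
    have "s i > 0" using sq(1)[OF i(1)] by (simp add: solid_square_def)
    then have "y $ k > c" using i(2) xy by force
    then have "i \<notin> L" using xy(2) by (auto simp: L_def)
    then show ?thesis using i(1) by (auto simp: R_def)
  qed
  ultimately have card: "card L > 0" "card R > 0"
    by (simp_all add: card_gt_0_iff L_def R_def)
  have LR: "L \<subseteq> {1..5}" by (auto simp: L_def)
  then have card5: "card L + card R = 5"
    unfolding R_def using card_mono[OF _ LR] by (simp add: card_Diff_subset finite_subset)
  have c: "0 < c" "c < 1"
  proof -
    obtain i j where "i \<in> L" "j \<in> R" using card by (metis card_gt_0_iff ex_in_conv)
    then show "0 < c" "c < 1"
      using side[OF PL, of i c] side[OF PR, of j "1 - c"] PL PR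
      by (force simp: packed_in_def solid_square_def)+
  qed
  have sum: "(\<Sum>i=1..5. s i) = sum s L + sum s R"
    unfolding R_def using LR by (simp add: sum.subset_diff)
  have times: "sum s J \<le> real (card J) * w"
    if "packed_in (rectangle k l a b 0 1) J Q s" "w = b - a" for w a b J
    using sum_bounded_above[of J s w] side[OF that(1) _ that(2)] by simp
  consider "card L = 1" "card R = 4" | "card L = 2" "card R = 3" | "card L = 3" "card R = 2"
    | "card L = 4" "card R = 1" using card card5 by linarith
  then show ?thesis
  proof cases
    case 1
    then show ?thesis
      using times[OF PL, of c] four_squares_in_rectangle[OF kl PR] c sum by simp
  next
    case 2
    then show ?thesis
      using times[OF PL, of c] two_squares_in_rectangle[OF kl PL] three_squares_in_rectangle[OF kl PR] c sum
      by (simp add: max_def split: if_splits)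
  next
    case 3
    then show ?thesis
      using times[OF PR, of "1 - c"] two_squares_in_rectangle[OF kl PR] three_squares_in_rectangle[OF kl PL] c sum
      by (simp add: max_def split: if_splits)
  next
    case 4
    then show ?thesis
      using times[OF PR, of "1 - c"] four_squares_in_rectangle[OF kl PL] c sum by simp
  qed
qed

end
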